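(* For $n\ge 2k+100\ln k$, almost all intersecting families in $\binom{[n]}{k}$ are trivial, and in fact the number $I(n,k,\ge 1)$ of non-trivial intersecting families in $\binom{[n]}{k}$ satisfies $$I(n,k,\ge 1)=o\left(2^{\binom{n-1}{k-1}}\right)\qquad\text{as } k\to\infty .$$ That is, for every $\varepsilon>0$ there is $k_0$ such that for all integers $k\ge k_0$ and $n\ge 2k+100\ln k$ we have $I(n,k,\ge 1)\le \varepsilon\, 2^{\binom{n-1}{k-1}}$, and the proportion of intersecting families $\mathcal{F}\subseteq\binom{[n]}{k}$ that are not trivial is at most $\varepsilon$.
   Context: $[n]=\{1,\dots,n\}$ and $\binom{[n]}{k}$ is the family of all $k$-element subsets of $[n]$. A family $\mathcal{F}\subseteq\binom{[n]}{k}$ is intersecting if every two of its members have non-empty intersection. A star is the family of all $k$-subsets of $[n]$ containing a fixed element of $[n]$. An intersecting family is trivial if it is contained in a star (i.e. there is an element of $[n]$ belonging to all of its members), and non-trivial otherwise. $I(n,k,\ge 1)$ denotes the number of non-trivial intersecting families $\mathcal{F}\subseteq\binom{[n]}{k}$. "Almost all" means that the proportion of intersecting families that are not trivial tends to zero as $k\to\infty$. *)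

theory Defs
  imports Complex_Main "HOL-Library.Ramsey"
begin

text \<open>
  The family of all \<open>k\<close>-element subsets of \<open>{1..n}\<close> is the library's \<open>nsets {1..n} k\<close>.
\<close>

definition intersecting :: "'a set set \<Rightarrow> bool" where
  "intersecting F \<longleftrightarrow> (\<forall>A\<in>F. \<forall>B\<in>F. A \<inter> B \<noteq> {})"

definition star :: "nat \<Rightarrow> nat \<Rightarrow> nat \<Rightarrow> nat set set" where
  "star n k x = {A \<in> nsets {1..n} k. x \<in> A}"

definition intersecting_families :: "nat \<Rightarrow> nat \<Rightarrow> nat set set set" where
  "intersecting_families n k = {F. F \<subseteq> nsets {1..n} k \<and> intersecting F}"

text \<open>The empty family is contained in every star, so it is trivial (for \<open>n \<ge> 1\<close>).\<close>

definition trivial_family :: "nat \<Rightarrow> nat \<Rightarrow> nat set set \<Rightarrow> bool" where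
  "trivial_family n k F \<longleftrightarrow> (\<exists>x\<in>{1..n}. F \<subseteq> star n k x)"

definition nontrivial_intersecting_families :: "nat \<Rightarrow> nat \<Rightarrow> nat set set set" where
  "nontrivial_intersecting_families n k =
     {F \<in> intersecting_families n k. \<not> trivial_family n k F}"

text \<open>The number \<open>I(n, k, \<ge> 1)\<close>.\<close>

definition I_nontrivial :: "nat \<Rightarrow> nat \<Rightarrow> nat" where
  "I_nontrivial n k = card (nontrivial_intersecting_families n k)"

definition nontrivial_proportion :: "nat \<Rightarrow> nat \<Rightarrow> real" where
  "nontrivial_proportion n k =
     real (I_nontrivial n k) / real (card (intersecting_families n k))"

end

theory Submission
  imports Defs
begin

text \<open>
  Let \<open>M\<close> be a maximal non-trivial intersecting family and \<open>N = C(n-1, k-1)\<close>. For an element \<open>x\<close>, let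
  \<open>B\<close> consist of the members of \<open>M\<close> avoiding \<open>x\<close> and let \<open>g\<close> be the number of \<open>(k-1)\<close>-sets in
  \<open>[n] - {x}\<close> that are disjoint from some member of \<open>B\<close>; by maximality \<open>|M| = N - g + |B|\<close>.
  The Erdos--Ko--Rado theorem and averaging over \<open>x\<close> give an \<open>x\<close> with
  \<open>|B| \<le> (1 - 1/n) C(n-2, k-1)\<close>, and below this threshold the Kruskal--Katona theorem yields
  \<open>|B| \<le> (1 - 1/(2n\<^sup>2)) g\<close>.

  An irredundant \<open>T \<subseteq> B\<close> avoided by the same \<open>k\<close>-sets as \<open>B\<close> determines \<open>M\<close>, and a local form of
  Bollobas's set-pair argument shows \<open>|T| N \<le> 4\<^sup>k n g\<close>. For \<open>n \<ge> 2k + 100 ln k\<close> the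
  number \<open>N\<close> exceeds \<open>4\<^sup>k\<close> by a large power of \<open>n\<close>, so \<open>|M| \<le> N - 2n|T|\<close>. Summing
  \<open>2\<^bsup>|M|\<^esup>\<close> over all \<open>x\<close> and all non-empty \<open>T\<close> gives at most \<open>2n 2\<^bsup>N-n\<^esup>\<close> families.
\<close>

section \<open>Shadows and the Kruskal--Katona theorem\<close>

lemma card_nsets: "finite A \<Longrightarrow> card (nsets A k) = card A choose k"
  using n_subsets[of A k] unfolding nsets_def
  by (metis (no_types, lifting) Collect_cong finite_subset)

lemma gbinomial_Suc_rec:
  fixes x :: real
  shows "real (Suc r) * (x gchoose Suc r) = (x - real r) * (x gchoose r)"
  using gbinomial_absorption[of r x] gbinomial_absorb_comp[of x r] by simp

text \<open>Telescoping: each factor is the ratio of two consecutive generalized binomial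
  coefficients with upper entry \<open>x\<close>. With \<open>a = 0\<close> it is the product
  formula for \<open>x gchoose i\<close>.\<close>

lemma gchoose_mult_prod:
  fixes x :: real
  shows "(x gchoose a) * (\<Prod>l<i. (x - real (a + l)) / real (Suc (a + l))) = x gchoose (a + i)"
proof (induction i)
  case (Suc i)
  then have "(x gchoose a) * (\<Prod>l<Suc i. (x - real (a + l)) / real (Suc (a + l)))
      = (x gchoose (a + i)) * ((x - real (a + i)) / real (Suc (a + i)))"
    by simp
  also have "\<dots> = x gchoose (a + Suc i)"
    using gbinomial_Suc_rec[of "a + i" x] by (simp add: field_simps del: of_nat_Suc)
  finally show ?case .
qed simp

lemma sum_degrees:
  assumes "finite F" "finite U" "\<And>A. A \<in> F \<Longrightarrow> A \<subseteq> U \<and> card A = r"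
  shows "(\<Sum>v\<in>U. card {A \<in> F. v \<in> A}) = r * card F"
proof (rule sum_multicount[OF assms(2,1)], rule ballI)
  fix A assume "A \<in> F"
  then have "{v \<in> U. v \<in> A} = A" using assms(3) by blast
  then show "card {v \<in> U. v \<in> A} = r" using assms(3) \<open>A \<in> F\<close> by simp
qed

lemma card_link: "card ((\<lambda>A. A - {v}) ` {A \<in> F. v \<in> A}) = card {A \<in> F. v \<in> A}"
  by (rule card_image) (auto simp: inj_on_def)

text \<open>Lovasz's form of the Kruskal--Katona theorem, following Keevash: the number of sets of
  \<open>F\<close> through \<open>v\<close> is bounded by induction on the link of \<open>v\<close> if \<open>v\<close> has small degree in \<open>G\<close>, and
  by the number of sets of \<open>G\<close> avoiding \<open>v\<close> otherwise.\<close>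

lemma kruskal_katona_ratio:
  fixes G F :: "'a set set" and x :: real
  assumes "r \<ge> 1" "finite G" "\<And>E. E \<in> G \<Longrightarrow> card E = r" "\<And>A. A \<in> F \<Longrightarrow> card A = Suc r"
    and "\<And>A a. A \<in> F \<Longrightarrow> a \<in> A \<Longrightarrow> A - {a} \<in> G"
    and "real (card G) \<le> x gchoose r" "x \<ge> real r"
  shows "real (Suc r) * real (card F) \<le> (x - real r) * real (card G)"
  using assms
proof (induction r arbitrary: G F x)
  case 0
  then show ?case by simp
next
  case (Suc r)
  define U where "U = \<Union>G"
  have finE: "finite E" if "E \<in> G" for E
    using Suc.prems(3)[OF that] card.infinite by fastforce
  have finU: "finite U" unfolding U_def using Suc.prems(2) finE by blast
  have FU: "A \<subseteq> U" if "A \<in> F" for A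
  proof
    fix a assume "a \<in> A"
    have "card A = Suc (Suc r)" using Suc.prems(4) that by blast
    then have "\<not> A \<subseteq> {a}" using card_mono[of "{a}" A] by auto
    then obtain b where "b \<in> A" "b \<noteq> a" by blast
    then show "a \<in> U" using Suc.prems(5)[OF that \<open>b \<in> A\<close>] \<open>a \<in> A\<close> U_def by blast
  qed
  have finF: "finite F" using FU finU by (meson PowI finite_Pow_iff finite_subset subsetI)
  define d where "d v = card {E \<in> G. v \<in> E}" for v
  define K where "K v = card {A \<in> F. v \<in> A}" for v
  \<comment> \<open>A local form of the claim: summed over \<open>v\<close>, the degrees in
    \<open>F\<close> and \<open>G\<close> add up to \<open>r + 2\<close> and \<open>r + 1\<close>
    times the family sizes.\<close>
  have vertex: "real (Suc r) * real (K v) \<le> (x - real (Suc r)) * real (d v)" for v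
  proof (cases "real (d v) \<ge> (x - 1) gchoose r")
    case True
    \<comment> \<open>Deleting \<open>v\<close> maps the sets of \<open>F\<close> through
      \<open>v\<close> injectively to sets of \<open>G\<close> that avoid \<open>v\<close>.\<close>
    have "K v \<le> card {E \<in> G. v \<notin> E}"
      unfolding K_def card_link[symmetric]
      by (rule card_mono) (use Suc.prems(2,5) in auto)
    moreover have "card G = d v + card {E \<in> G. v \<notin> E}"
      unfolding d_def using Suc.prems(2)
      by (subst card_Un_disjoint[symmetric]) (auto intro!: arg_cong[where f = card])
    ultimately have "real (K v) + real (d v) \<le> x gchoose Suc r"
      using Suc.prems(6) by linarith
    then have "real (Suc r) * (real (K v) + real (d v)) \<le> x * ((x - 1) gchoose r)"
      using gbinomial_absorption[of r x] mult_left_mono[of _ _ "real (Suc r)"] by fastforce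
    also have "\<dots> \<le> x * real (d v)"
      using True Suc.prems(7) by (intro mult_left_mono) auto
    finally show ?thesis by (simp add: algebra_simps)
  next
    case False
    show ?thesis
    proof (cases "r = 0 \<or> d v = 0")
      case True
      \<comment> \<open>For \<open>r = 0\<close> the failed case condition reads
        \<open>d v < 1\<close>, since \<open>(x - 1) gchoose 0 = 1\<close>.\<close>
      with False have d0: "d v = 0" by auto
      have none: "{A \<in> F. v \<in> A} = {}"
      proof (rule ccontr)
        assume "{A \<in> F. v \<in> A} \<noteq> {}"
        then obtain A where A: "A \<in> F" "v \<in> A" by blast
        have "v \<in> \<Union>G" using FU[OF A(1)] A(2) U_def by blast
        then have "{E \<in> G. v \<in> E} \<noteq> {}" by blast
        then show False using d0 Suc.prems(2) unfolding d_def by auto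
      qed
      then show ?thesis unfolding K_def none using Suc.prems(7) by simp
    next
      case r: False
      let ?Gv = "(\<lambda>E. E - {v}) ` {E \<in> G. v \<in> E}" and ?Fv = "(\<lambda>A. A - {v}) ` {A \<in> F. v \<in> A}"
      have "real (Suc r) * real (card ?Fv) \<le> ((x - 1) - real r) * real (card ?Gv)"
      proof (rule Suc.IH)
        show "1 \<le> r" using r by simp
        show "finite ?Gv" using Suc.prems(2) by simp
        show "card E = r" if "E \<in> ?Gv" for E using that Suc.prems(3) by auto
        show "card A = Suc r" if "A \<in> ?Fv" for A using that Suc.prems(4) by auto
        show "A - {a} \<in> ?Gv" if "A \<in> ?Fv" "a \<in> A" for A a
        proof -
          obtain A' where A': "A' \<in> F" "v \<in> A'" "A = A' - {v}" using \<open>A \<in> ?Fv\<close> by blast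
          then have "A' - {a} \<in> G" "v \<in> A' - {a}" using Suc.prems(5) \<open>a \<in> A\<close> by auto
          moreover have "A - {a} = A' - {a} - {v}" using A' by blast
          ultimately show ?thesis by blast
        qed
        show "real (card ?Gv) \<le> x - 1 gchoose r" using False unfolding card_link d_def by simp
        show "real r \<le> x - 1" using Suc.prems(7) by simp
      qed
      then show ?thesis unfolding card_link K_def d_def by (simp add: algebra_simps)
    qed
  qed
  have "real (Suc r) * (real (Suc (Suc r)) * real (card F)) = (\<Sum>v\<in>U. real (Suc r) * real (K v))"
    using sum_degrees[OF finF finU, of "Suc (Suc r)"] FU Suc.prems(4) unfolding K_def
    by (simp flip: sum_distrib_left of_nat_sum of_nat_mult del: of_nat_Suc mult_Suc)
  also have "\<dots> \<le> (\<Sum>v\<in>U. (x - real (Suc r)) * real (d v))"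
    by (rule sum_mono) (rule vertex)
  also have "\<dots> = (x - real (Suc r)) * (real (Suc r) * real (card G))"
    using sum_degrees[OF Suc.prems(2) finU, of "Suc r"] Suc.prems(3) unfolding d_def U_def
    by (auto simp flip: sum_distrib_left of_nat_sum of_nat_mult simp del: of_nat_Suc mult_Suc)
  finally have "real (Suc r) * (real (Suc (Suc r)) * real (card F))
      \<le> real (Suc r) * ((x - real (Suc r)) * real (card G))"
    by (simp only: mult_ac)
  then show ?case by (rule mult_left_le_imp_le) simp
qed

section \<open>Levels of the down-set generated by complements\<close>

text \<open>These are the \<open>j\<close>-subsets of the complements \<open>V - b\<close>, so
  deleting a point of an avoider leaves an avoider one level lower. Kruskal--Katona is applied
  between consecutive levels.\<close>

definition avoiders :: "'a set \<Rightarrow> nat \<Rightarrow> 'a set set \<Rightarrow> 'a set set" where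
  "avoiders V j B = {z \<in> nsets V j. \<exists>b\<in>B. z \<inter> b = {}}"

lemma finite_avoiders: "finite V \<Longrightarrow> finite (avoiders V j B)"
  unfolding avoiders_def by (simp add: finite_imp_finite_nsets)

text \<open>A set of this size that misses \<open>b\<close> must be the complement of
  \<open>b\<close>. The size of \<open>B\<close> thus becomes the size of the top level.\<close>

lemma card_avoiders_top:
  assumes V: "finite V" and B: "B \<subseteq> nsets V k"
  shows "card (avoiders V (card V - k) B) = card B"
proof -
  have "avoiders V (card V - k) B = (\<lambda>b. V - b) ` B"
  proof (intro equalityI subsetI)
    fix z assume "z \<in> avoiders V (card V - k) B"
    then obtain b where z: "z \<subseteq> V" "card z = card V - k" "b \<in> B" "z \<inter> b = {}"
      unfolding avoiders_def nsets_def by blast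
    have "b \<subseteq> V" "card b = k" using B z(3) by (auto simp: nsets_def)
    then have "card (V - b) = card z" using V z by (simp add: card_Diff_subset finite_subset)
    then have "z = V - b" using V z by (intro card_subset_eq) auto
    then show "z \<in> (\<lambda>b. V - b) ` B" using z by blast
  next
    fix z assume "z \<in> (\<lambda>b. V - b) ` B"
    then obtain b where "b \<in> B" "z = V - b" by blast
    moreover have "b \<subseteq> V" "card b = k" using B \<open>b \<in> B\<close> by (auto simp: nsets_def)
    ultimately show "z \<in> avoiders V (card V - k) B"
      using V unfolding avoiders_def nsets_def by (auto simp: card_Diff_subset finite_subset)
  qed
  moreover have "inj_on (\<lambda>b. V - b) B" using B unfolding inj_on_def nsets_def by blast
  ultimately show ?thesis by (simp add: card_image)
qed

text \<open>Climbs one level at a time with \<open>kruskal_katona_ratio\<close>. The product turns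
  \<open>x gchoose a\<close> into \<open>x gchoose (a + i)\<close>, so the size hypothesis of that
  lemma holds again on each new level.\<close>

lemma card_avoiders_le:
  fixes x :: real
  assumes V: "finite V" and a: "a \<ge> 1" and x: "x + 1 \<ge> real (a + i)"
    and le: "real (card (avoiders V a B)) \<le> x gchoose a"
  shows "real (card (avoiders V (a + i) B))
    \<le> real (card (avoiders V a B)) * (\<Prod>l<i. (x - real (a + l)) / real (Suc (a + l)))"
  using x
proof (induction i)
  case 0
  then show ?case by simp
next
  case (Suc i)
  let ?P = "\<lambda>i. \<Prod>l<i. (x - real (a + l)) / real (Suc (a + l))"
  have P_nonneg: "?P i \<ge> 0" using Suc.prems by (intro prod_nonneg) auto
  have IH: "real (card (avoiders V (a + i) B)) \<le> real (card (avoiders V a B)) * ?P i"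
    using Suc by simp
  also have "\<dots> \<le> x gchoose (a + i)"
    unfolding gchoose_mult_prod[symmetric] using le P_nonneg by (rule mult_right_mono)
  finally have "real (Suc (a + i)) * real (card (avoiders V (Suc (a + i)) B))
      \<le> (x - real (a + i)) * real (card (avoiders V (a + i) B))"
    using Suc.prems a finite_avoiders[OF V]
    by (intro kruskal_katona_ratio) (auto simp: avoiders_def nsets_def)
  also have "\<dots> \<le> (x - real (a + i)) * (real (card (avoiders V a B)) * ?P i)"
    using IH Suc.prems by (intro mult_left_mono) auto
  finally show ?case by (simp add: field_simps del: of_nat_Suc)
qed

section \<open>Erdos--Ko--Rado and expansion of avoiders\<close>

text \<open>Daykin's argument. An intersecting family is disjoint from its own
  level-\<open>k\<close> avoiders, so either it is small or there are at most
  \<open>n - 1 choose k\<close> avoiders. In the latter case climbing with \<open>x = n - 1\<close>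
  from level \<open>k\<close> to level \<open>n - k\<close>, where the avoiders are the complements
  of \<open>F\<close>, gives the bound.\<close>

theorem erdos_ko_rado:
  assumes V: "finite V" and k: "1 \<le> k" "2 * k \<le> card V"
    and F: "F \<subseteq> nsets V k" "intersecting F"
  shows "card F \<le> (card V - 1) choose (k - 1)"
proof -
  define n where "n = card V"
  have disj: "F \<inter> avoiders V k F = {}"
    using F unfolding avoiders_def intersecting_def by blast
  have finF: "finite F" using F V finite_imp_finite_nsets finite_subset by blast
  have "F \<union> avoiders V k F \<subseteq> nsets V k" using F unfolding avoiders_def by blast
  then have "card F + card (avoiders V k F) \<le> n choose k"
    using card_mono[OF finite_imp_finite_nsets[OF V]] card_Un_disjoint[OF finF finite_avoiders[OF V] disj]
    by (metis V card_nsets n_def)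
  moreover have "n choose k = (n - 1 choose (k - 1)) + (n - 1 choose k)"
    using k unfolding n_def by (intro choose_reduce_nat) auto
  moreover have "card F \<le> n - 1 choose (k - 1)" if le: "card (avoiders V k F) \<le> n - 1 choose k"
  proof -
    let ?x = "real (n - 1)" and ?P = "\<Prod>l<n - 2 * k. (real (n - 1) - real (k + l)) / real (Suc (k + l))"
    have "real (card F) = real (card (avoiders V (k + (n - 2 * k)) F))"
      using card_avoiders_top[OF V F(1)] k unfolding n_def by simp
    also have "\<dots> \<le> real (card (avoiders V k F)) * ?P"
    proof (intro card_avoiders_le V)
      show "real (card (avoiders V k F)) \<le> ?x gchoose k"
        using le by (simp only: of_nat_le_iff flip: binomial_gbinomial)
    qed (use k in \<open>auto simp: n_def\<close>)
    also have "\<dots> \<le> real (n - 1 choose k) * ?P"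
      using le k unfolding n_def by (intro mult_right_mono prod_nonneg) auto
    also have "\<dots> = real (n - 1 choose (k + (n - 2 * k)))"
      using gchoose_mult_prod[of ?x k "n - 2 * k"] by (simp flip: binomial_gbinomial)
    also have "\<dots> = real (n - 1 choose (k - 1))"
      using k unfolding n_def by (subst binomial_symmetric) (auto intro!: arg_cong2[where f = binomial])
    finally show ?thesis by linarith
  qed
  ultimately show ?thesis unfolding n_def by linarith
qed

text \<open>With \<open>x = n - 2\<close> the climb from level \<open>k - 1\<close> to level
  \<open>n - 1 - k\<close> has total factor 1, by symmetry of binomial coefficients. Lowering
  \<open>x\<close> slightly gains a factor below 1; if there are too many avoiders for the lowered
  \<open>x\<close>, the slack in \<open>le\<close> suffices instead.\<close>

lemma card_avoiders_expand:
  assumes V: "finite V" and n: "n = Suc (card V)" and k: "2 \<le> k" "2 * k + 1 \<le> n"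
    and B: "B \<subseteq> nsets V k"
    and le: "real (card B) \<le> (1 - 1 / real n) * real (n - 2 choose (k - 1))"
  shows "real (card B) \<le> (1 - 1 / (2 * real n ^ 2)) * real (card (avoiders V (k - 1) B))"
proof -
  \<comment> \<open>Half of the slack \<open>1 / n\<close> in \<open>le\<close>:
    \<open>(1 - \<delta>) * (1 - \<delta> / n)\<close> is still at least \<open>1 - 1 / n\<close>,
    and \<open>\<delta> / n\<close> is the final gain.\<close>
  define \<delta> where "\<delta> = 1 / (2 * real n)"
  define x where "x = real (n - 2) - \<delta>"
  define a where "a = k - 1"
  define g where "g = real (card (avoiders V a B))"
  have n5: "n \<ge> 5" using k by linarith
  have \<delta>: "0 < \<delta>" "\<delta> < 1" using n5 unfolding \<delta>_def by (auto simp: field_simps)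
  have a: "a \<ge> 1" "k = Suc a" using k unfolding a_def by auto
  have \<delta>n: "\<delta> / real n = 1 / (2 * real n ^ 2)" unfolding \<delta>_def by (simp add: power2_eq_square)
  have "real (card B) \<le> (1 - \<delta> / real n) * g"
  proof (cases "g \<le> x gchoose a")
    case True
    let ?s = "n - 2 * k"
    have "real (card B) = real (card (avoiders V (a + ?s) B))"
      using card_avoiders_top[OF V B] k n a by (simp add: add.commute)
    also have "\<dots> \<le> g * (\<Prod>l<?s. (x - real (a + l)) / real (Suc (a + l)))"
      unfolding g_def using True[unfolded g_def] a \<delta> k
      by (intro card_avoiders_le V) (auto simp: x_def)
    also have "\<dots> \<le> g * (1 - \<delta> / real n)"
    proof (rule mult_left_mono)
      let ?Q = "\<lambda>l. (real (n - 2) - real (a + l)) / real (Suc (a + l))"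
      have q0: "0 \<le> 1 - \<delta> / real n" "1 - \<delta> / real n \<le> 1"
        using \<delta> n5 by (auto simp: field_simps)
      \<comment> \<open>Each numerator is at most \<open>n\<close>, so lowering it by
        \<open>\<delta>\<close> removes at least the proportion \<open>\<delta> / n\<close>.\<close>
      have "(\<Prod>l<?s. (x - real (a + l)) / real (Suc (a + l))) \<le> (\<Prod>l<?s. (1 - \<delta> / real n) * ?Q l)"
      proof (intro prod_mono conjI)
        fix l assume "l \<in> {..<?s}"
        then have l: "real (a + l) + 1 \<le> real (n - 2)" using a k by auto
        then show "0 \<le> (x - real (a + l)) / real (Suc (a + l))"
          using \<delta> unfolding x_def by (intro divide_nonneg_nonneg) auto
        have "\<delta> / real n * (real (n - 2) - real (a + l)) \<le> \<delta> / real n * real n"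
          using \<delta> by (intro mult_left_mono) auto
        then have "x - real (a + l) \<le> (1 - \<delta> / real n) * (real (n - 2) - real (a + l))"
          using n5 unfolding x_def by (simp add: algebra_simps)
        then show "(x - real (a + l)) / real (Suc (a + l)) \<le> (1 - \<delta> / real n) * ?Q l"
          unfolding times_divide_eq_right by (rule divide_right_mono) simp
      qed
      also have "\<dots> = (1 - \<delta> / real n) ^ ?s * (\<Prod>l<?s. ?Q l)" by (simp only: prod.distrib prod_constant card_lessThan)
      also have "(\<Prod>l<?s. ?Q l) = 1"
      proof -
        have "real (n - 2 choose a) * (\<Prod>l<?s. ?Q l) = real (n - 2 choose (a + ?s))"
          using gchoose_mult_prod[of "real (n - 2)" a ?s] by (simp flip: binomial_gbinomial)
        also have "n - 2 choose (a + ?s) = n - 2 choose a"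
          using a k by (subst binomial_symmetric) (auto intro!: arg_cong2[where f = binomial])
        finally have "real (n - 2 choose a) * (\<Prod>l<?s. ?Q l) = real (n - 2 choose a) * 1"
          by simp
        moreover have "real (n - 2 choose a) \<noteq> 0" using a k by simp
        ultimately show ?thesis by (metis mult_left_cancel)
      qed
      \<comment> \<open>There is at least one level to climb, because
        \<open>2 * k + 1 \<le> n\<close>.\<close>
      also have "(1 - \<delta> / real n) ^ ?s * 1 \<le> (1 - \<delta> / real n) ^ 1 * 1"
        using q0 k by (intro mult_right_mono power_decreasing) auto
      finally show "(\<Prod>l<?s. (x - real (a + l)) / real (Suc (a + l))) \<le> 1 - \<delta> / real n" by simp
    qed (simp add: g_def)
    finally show ?thesis by (simp add: mult.commute)
  next
    case False
    let ?C = "real (n - 2 choose a)"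
    \<comment> \<open>Each of the \<open>a\<close> numerators is at least \<open>n - k\<close>, so
      it shrinks by a factor of at least \<open>1 - \<delta> / (n - k)\<close>; Bernoulli's
      inequality and \<open>a \<le> n - k\<close> bound the product.\<close>
    have "(1 - \<delta>) * ?C \<le> x gchoose a"
    proof -
      have na: "real a \<le> real (n - k)" "0 < real (n - k)" using a k by auto
      have "real a / real (n - k) \<le> 1" using na by simp
      then have "\<delta> * (real a / real (n - k)) \<le> \<delta> * 1" using \<delta> by (intro mult_left_mono) auto
      then have "1 - \<delta> \<le> 1 + real a * (- \<delta> / real (n - k))" by (simp add: mult.commute)
      also have "\<dots> \<le> (1 + (- \<delta> / real (n - k))) ^ a"
        using na \<delta> by (intro Bernoulli_inequality) (simp add: field_simps)
      also have "\<dots> = (1 - \<delta> / real (n - k)) ^ a" by simp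
      finally have "(1 - \<delta>) * (\<Prod>l<a. (real (n - 2) - real l) / real (Suc l))
          \<le> (1 - \<delta> / real (n - k)) ^ a * (\<Prod>l<a. (real (n - 2) - real l) / real (Suc l))"
        using a k by (intro mult_right_mono prod_nonneg) auto
      also have "\<dots> = (\<Prod>l<a. (1 - \<delta> / real (n - k)) * ((real (n - 2) - real l) / real (Suc l)))"
        by (simp only: prod.distrib prod_constant card_lessThan)
      also have "\<dots> \<le> (\<Prod>l<a. (x - real l) / real (Suc l))"
      proof (intro prod_mono conjI)
        fix l assume "l \<in> {..<a}"
        then have l: "real (n - k) \<le> real (n - 2) - real l" using a k by auto
        have "\<delta> / real (n - k) \<le> 1" using na \<delta> by (simp add: field_simps)
        then show "0 \<le> (1 - \<delta> / real (n - k)) * ((real (n - 2) - real l) / real (Suc l))"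
          using l na by (intro mult_nonneg_nonneg divide_nonneg_nonneg) auto
        have "\<delta> / real (n - k) * real (n - k) \<le> \<delta> / real (n - k) * (real (n - 2) - real l)"
          using \<delta> na l by (intro mult_left_mono) auto
        moreover have "\<delta> / real (n - k) * real (n - k) = \<delta>" using na by simp
        ultimately have "(1 - \<delta> / real (n - k)) * (real (n - 2) - real l) \<le> x - real l"
          unfolding x_def left_diff_distrib mult_1_left by linarith
        then show "(1 - \<delta> / real (n - k)) * ((real (n - 2) - real l) / real (Suc l))
            \<le> (x - real l) / real (Suc l)"
          unfolding times_divide_eq_right by (rule divide_right_mono) simp
      qed
      finally show ?thesis
        using gchoose_mult_prod[of "real (n - 2)" 0 a] gchoose_mult_prod[of x 0 a]
        by (simp flip: binomial_gbinomial)
    qed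
    then have g: "(1 - \<delta>) * ?C \<le> g" using False by linarith
    have "1 - 1 / real n \<le> (1 - \<delta> / real n) * (1 - \<delta>)"
    proof -
      have "\<delta> / real n \<le> \<delta> * 1" using \<delta> n5 by (simp add: field_simps)
      moreover have "\<delta> / real n * \<delta> \<ge> 0" using \<delta> by simp
      moreover have "1 / real n = 2 * \<delta>" unfolding \<delta>_def by simp
      moreover have "(1 - \<delta> / real n) * (1 - \<delta>) = 1 - \<delta> - \<delta> / real n + \<delta> / real n * \<delta>"
        by (simp add: left_diff_distrib right_diff_distrib)
      ultimately show ?thesis by linarith
    qed
    then have "(1 - 1 / real n) * ?C \<le> (1 - \<delta> / real n) * (1 - \<delta>) * ?C"
      by (intro mult_right_mono) auto
    also have "\<dots> \<le> (1 - \<delta> / real n) * g"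
      unfolding mult.assoc using g \<delta> n5 by (intro mult_left_mono) (auto simp: field_simps)
    finally show ?thesis using le unfolding a_def by linarith
  qed
  then show ?thesis unfolding \<delta>n g_def a_def .
qed

section \<open>Irredundant subfamilies\<close>

lemma avoiders_mono: "T \<subseteq> B \<Longrightarrow> avoiders V j T \<subseteq> avoiders V j B"
  unfolding avoiders_def by blast

text \<open>\<open>T\<close> is inclusion-minimal among the subfamilies with the same
  avoiders.\<close>

lemma ex_irredundant:
  assumes "finite B"
  obtains T where "T \<subseteq> B" "avoiders V k T = avoiders V k B"
    "\<And>b. b \<in> T \<Longrightarrow> avoiders V k (T - {b}) \<noteq> avoiders V k T"
proof -
  let ?S = "{T. T \<subseteq> B \<and> avoiders V k T = avoiders V k B}"
  have "finite ?S" "B \<in> ?S" using assms by auto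
  from finite_has_minimal2[OF this] obtain T where T: "T \<in> ?S" "\<forall>S\<in>?S. S \<subseteq> T \<longrightarrow> T = S"
    by (elim bexE conjE)
  have "avoiders V k (T - {b}) \<noteq> avoiders V k T" if b: "b \<in> T" for b
  proof
    assume "avoiders V k (T - {b}) = avoiders V k T"
    then have "T - {b} \<in> ?S" using T(1) by auto
    then have "T = T - {b}" using T(2) by (metis Diff_subset)
    then show False using b by blast
  qed
  from that[OF _ _ this] T(1) show thesis by simp
qed

text \<open>Each \<open>b \<in> T\<close> has a witness \<open>w b\<close> disjoint from \<open>b\<close> alone; then the intervals between
  \<open>w b\<close> and \<open>V - b\<close> are pairwise disjoint, and their \<open>j\<close>-th levels consist of avoiders of \<open>T\<close>.\<close>

lemma card_irredundant_mult_le: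
  assumes V: "finite V" and T: "T \<subseteq> nsets V k"
    and irr: "\<And>b. b \<in> T \<Longrightarrow> avoiders V k (T - {b}) \<noteq> avoiders V k T"
    and j: "k \<le> j"
  shows "card T * (card V - 2 * k choose (j - k)) \<le> card (avoiders V j T)"
proof -
  have finT: "finite T" using T V finite_imp_finite_nsets finite_subset by blast
  have "\<forall>b\<in>T. \<exists>w. w \<in> nsets V k \<and> w \<inter> b = {} \<and> (\<forall>c\<in>T - {b}. w \<inter> c \<noteq> {})"
  proof
    fix b assume "b \<in> T"
    \<comment> \<open>An avoider of \<open>T\<close> that is lost without \<open>b\<close> misses
      \<open>b\<close> and meets every other member; it serves as the witness.\<close>
    then have "\<not> avoiders V k T \<subseteq> avoiders V k (T - {b})"
      using irr avoiders_mono[of "T - {b}" T V k] by blast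
    then show "\<exists>w. w \<in> nsets V k \<and> w \<inter> b = {} \<and> (\<forall>c\<in>T - {b}. w \<inter> c \<noteq> {})"
      unfolding avoiders_def by blast
  qed
  from bchoice[OF this] obtain w where
    "\<forall>b\<in>T. w b \<in> nsets V k \<and> w b \<inter> b = {} \<and> (\<forall>c\<in>T - {b}. w b \<inter> c \<noteq> {})" ..
  then have w: "\<And>b. b \<in> T \<Longrightarrow> w b \<in> nsets V k" "\<And>b. b \<in> T \<Longrightarrow> w b \<inter> b = {}"
      "\<And>b c. b \<in> T \<Longrightarrow> c \<in> T \<Longrightarrow> c \<noteq> b \<Longrightarrow> w b \<inter> c \<noteq> {}"
    by auto
  define I where "I b = (\<lambda>S. w b \<union> S) ` nsets (V - b - w b) (j - k)" for b
  have cardI: "card (I b) = card V - 2 * k choose (j - k)" if b: "b \<in> T" for b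
  proof -
    have sub: "b \<subseteq> V" "w b \<subseteq> V" "card b = k" "card (w b) = k" "finite b" "finite (w b)"
      using T b w(1)[OF b] by (auto simp: nsets_def)
    have "V - b - w b = V - (b \<union> w b)" by blast
    moreover have "card (b \<union> w b) = 2 * k"
      using sub w(2)[OF b] by (subst card_Un_disjoint) auto
    ultimately have "card (V - b - w b) = card V - 2 * k"
      using sub by (simp add: card_Diff_subset)
    moreover have "inj_on (\<lambda>S. w b \<union> S) (nsets (V - b - w b) (j - k))"
      unfolding inj_on_def nsets_def by blast
    ultimately show ?thesis unfolding I_def using V by (simp add: card_image card_nsets)
  qed
  \<comment> \<open>A common set would contain \<open>w b\<close> and miss \<open>c\<close>,
    although \<open>w b\<close> meets \<open>c\<close>.\<close>
  have disj: "I b \<inter> I c = {}" if "b \<in> T" "c \<in> T" "b \<noteq> c" for b c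
    using w(2)[OF that(2)] w(3)[OF that(1,2)] that unfolding I_def nsets_def by blast
  have "I b \<subseteq> avoiders V j T" if b: "b \<in> T" for b
  proof
    fix z assume "z \<in> I b"
    then obtain S where S: "z = w b \<union> S" "S \<subseteq> V - b - w b" "finite S" "card S = j - k"
      unfolding I_def nsets_def by blast
    have wb: "w b \<subseteq> V" "card (w b) = k" "finite (w b)" using w(1)[OF b] by (auto simp: nsets_def)
    have "card z = j" unfolding S(1) using S wb j by (subst card_Un_disjoint) auto
    then show "z \<in> avoiders V j T"
      using S wb b w(2)[OF b] unfolding avoiders_def nsets_def by blast
  qed
  then have "card (\<Union>b\<in>T. I b) \<le> card (avoiders V j T)"
    by (intro card_mono finite_avoiders V) blast
  moreover have "card (\<Union>b\<in>T. I b) = (\<Sum>b\<in>T. card (I b))"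
    by (rule card_UN_disjoint[OF finT]) (use disj V in \<open>auto simp: I_def finite_imp_finite_nsets\<close>)
  ultimately show ?thesis using cardI by simp
qed

text \<open>Normalized matching by double counting inclusions: each \<open>a\<close>-subset of a
  level-\<open>j\<close> avoider is an avoider, while an \<open>a\<close>-set lies in only
  \<open>card V - a choose (j - a)\<close> sets of size \<open>j\<close>.\<close>

lemma card_avoiders_normalized:
  assumes V: "finite V" and aj: "a \<le> j" "j \<le> card V"
  shows "card (avoiders V j T) * (card V choose a) \<le> card (avoiders V a T) * (card V choose j)"
proof -
  let ?Dj = "avoiders V j T" and ?Da = "avoiders V a T"
  have down: "card {w \<in> ?Da. w \<subseteq> z} = j choose a" if "z \<in> ?Dj" for z
  proof -
    have "{w \<in> ?Da. w \<subseteq> z} = nsets z a"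
      using that unfolding avoiders_def nsets_def by blast
    then show ?thesis using that card_nsets[of z a] by (auto simp: avoiders_def nsets_def)
  qed
  have up: "card {z \<in> ?Dj. w \<subseteq> z} \<le> card V - a choose (j - a)" if "w \<in> ?Da" for w
  proof -
    have w: "w \<subseteq> V" "finite w" "card w = a" using that by (auto simp: avoiders_def nsets_def)
    have "card {z \<in> ?Dj. w \<subseteq> z} = card ((\<lambda>z. z - w) ` {z \<in> ?Dj. w \<subseteq> z})"
      by (rule card_image[symmetric]) (auto simp: inj_on_def)
    also have "\<dots> \<le> card (nsets (V - w) (j - a))"
      using w V by (intro card_mono finite_imp_finite_nsets)
        (auto simp: avoiders_def nsets_def card_Diff_subset)
    also have "\<dots> = card V - a choose (j - a)"
      using w V by (simp add: card_nsets card_Diff_subset)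
    finally show ?thesis .
  qed
  have "(\<Sum>w\<in>?Da. card {z \<in> ?Dj. w \<subseteq> z}) = (\<Sum>z\<in>?Dj. j choose a)"
    by (rule sum_multicount_gen) (use down finite_avoiders[OF V] in auto)
  moreover have "(\<Sum>w\<in>?Da. card {z \<in> ?Dj. w \<subseteq> z}) \<le> (\<Sum>w\<in>?Da. card V - a choose (j - a))"
    by (rule sum_mono) (rule up)
  ultimately have "card ?Dj * (j choose a) \<le> card ?Da * (card V - a choose (j - a))" by simp
  then have "(card V choose a) * (card ?Dj * (j choose a))
      \<le> (card V choose a) * (card ?Da * (card V - a choose (j - a)))"
    by (rule mult_le_mono2)
  also have "\<dots> = card ?Da * ((card V choose a) * (card V - a choose (j - a)))"
    by (simp only: mult_ac)
  also have "\<dots> = card ?Da * ((card V choose j) * (j choose a))"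
    using choose_mult[OF aj] by simp
  finally have "(card ?Dj * (card V choose a)) * (j choose a)
      \<le> (card ?Da * (card V choose j)) * (j choose a)"
    by (simp only: mult_ac)
  then show ?thesis using aj by simp
qed

text \<open>At the middle level \<open>j\<close> the interval bound has coefficient
  \<open>p choose (p div 2)\<close>, which is at least \<open>2 ^ p / (card V + 1)\<close>.
  Descending to level \<open>k - 1\<close> costs \<open>card V choose j\<close>, at most
  \<open>2 ^ p * 4 ^ k\<close>, and \<open>2 ^ p\<close> cancels.\<close>

lemma card_irredundant_le:
  assumes V: "finite V" "2 * k \<le> card V" and T: "T \<subseteq> nsets V k"
    and irr: "\<And>b. b \<in> T \<Longrightarrow> avoiders V k (T - {b}) \<noteq> avoiders V k T"
  shows "card T * (card V choose (k - 1)) \<le> card (avoiders V (k - 1) T) * (4 ^ k * Suc (card V))"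
proof -
  define p where "p = card V - 2 * k"
  define j where "j = k + p div 2"
  let ?N = "card V choose (k - 1)" and ?g = "card (avoiders V (k - 1) T)"
  have "2 ^ p = (\<Sum>i\<le>p. p choose i)" by (simp add: choose_row_sum)
  also have "\<dots> \<le> (\<Sum>i\<le>p. p choose (p div 2))" by (intro sum_mono binomial_maximum)
  also have "\<dots> \<le> Suc (card V) * (p choose (p div 2))" unfolding p_def by simp
  finally have "2 ^ p * (card T * ?N) \<le> Suc (card V) * (p choose (p div 2)) * (card T * ?N)"
    by (rule mult_le_mono1)
  also have "\<dots> = Suc (card V) * (card T * (p choose (j - k)) * ?N)"
    unfolding j_def by (simp only: mult_ac add_diff_cancel_left')
  also have "\<dots> \<le> Suc (card V) * (card (avoiders V j T) * ?N)"
    using card_irredundant_mult_le[OF V(1) T irr, of j]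
    unfolding p_def j_def by (intro mult_le_mono1 mult_le_mono2) auto
  also have "\<dots> \<le> Suc (card V) * (?g * (card V choose j))"
    using V unfolding j_def p_def by (intro mult_le_mono2 card_avoiders_normalized) auto
  also have "\<dots> \<le> Suc (card V) * (?g * 2 ^ card V)"
    by (intro mult_le_mono2 binomial_le_pow2)
  also have "2 ^ card V = 2 ^ p * (4 ^ k :: nat)"
  proof -
    have "(2 :: nat) ^ card V = 2 ^ (p + 2 * k)" using V(2) unfolding p_def by simp
    then show ?thesis by (simp add: power_add power_mult)
  qed
  finally have "2 ^ p * (card T * ?N) \<le> 2 ^ p * (?g * (4 ^ k * Suc (card V)))"
    by (simp only: mult_ac)
  then show ?thesis by simp
qed

text \<open>A \<open>(k - 1)\<close>-set and a disjoint \<open>b\<close> cover fewer than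
  \<open>card V\<close> points, so the set extends to a level-\<open>k\<close> avoider; the member
  of \<open>T\<close> missed by the extension is missed by the set too.\<close>

lemma avoiders_pred_eq:
  assumes V: "finite V" "2 * k \<le> card V" "1 \<le> k" and B: "B \<subseteq> nsets V k" and T: "T \<subseteq> B"
    and eq: "avoiders V k T = avoiders V k B"
  shows "avoiders V (k - 1) T = avoiders V (k - 1) B"
proof
  show "avoiders V (k - 1) T \<subseteq> avoiders V (k - 1) B" using T by (rule avoiders_mono)
  show "avoiders V (k - 1) B \<subseteq> avoiders V (k - 1) T"
  proof
    fix w assume w: "w \<in> avoiders V (k - 1) B"
    then obtain b where b: "b \<in> B" "w \<inter> b = {}" unfolding avoiders_def by blast
    have fin: "b \<subseteq> V" "finite b" "card b = k" "w \<subseteq> V" "finite w" "card w = k - 1"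
      using w b B by (auto simp: avoiders_def nsets_def)
    have "card (w \<union> b) < card V" using card_Un_le[of w b] fin V by linarith
    then obtain v where v: "v \<in> V" "v \<notin> w" "v \<notin> b"
      using card_mono[of "w \<union> b" V] fin by fastforce
    have "insert v w \<in> nsets V k" using v fin V(3) by (simp add: nsets_def)
    then have "insert v w \<in> avoiders V k T"
      unfolding eq using v(3) b unfolding avoiders_def by blast
    then obtain t where "t \<in> T" "insert v w \<inter> t = {}"
      unfolding avoiders_def by blast
    then show "w \<in> avoiders V (k - 1) T" using w unfolding avoiders_def by blast
  qed
qed

section \<open>Maximal intersecting families\<close>

text \<open>A decoding map that rebuilds a maximal family from \<open>x\<close> and \<open>T\<close>
  alone: \<open>P\<close> is to be its members through \<open>x\<close>, the second part its members
  avoiding \<open>x\<close>.\<close>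

definition generated :: "'a set \<Rightarrow> nat \<Rightarrow> 'a \<Rightarrow> 'a set set \<Rightarrow> 'a set set" where
  "generated U k x T =
    (let P = {a \<in> nsets U k. x \<in> a \<and> (\<forall>t\<in>T. a \<inter> t \<noteq> {})}
     in P \<union> {z \<in> nsets U k. x \<notin> z \<and> (\<forall>t\<in>T. z \<inter> t \<noteq> {}) \<and> (\<forall>a\<in>P. z \<inter> a \<noteq> {})})"

locale maximal_intersecting =
  fixes U :: "'a set" and k :: nat and M :: "'a set set"
  assumes finite_U: "finite U" and k: "2 \<le> k" "2 * k < card U"
    and M: "M \<subseteq> nsets U k" "intersecting M"
    and maximal: "\<And>z. z \<in> nsets U k \<Longrightarrow> (\<And>y. y \<in> M \<Longrightarrow> z \<inter> y \<noteq> {}) \<Longrightarrow> z \<in> M"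
begin

definition rest :: "'a \<Rightarrow> 'a set set" where
  "rest x = {b \<in> M. x \<notin> b}"

lemma rest_subset: "rest x \<subseteq> nsets (U - {x}) k"
  using M unfolding rest_def nsets_def by blast

lemma finite_M: "finite M"
  using M(1) finite_U finite_imp_finite_nsets finite_subset by blast

text \<open>By maximality, adding \<open>x\<close> to a \<open>(k - 1)\<close>-subset of
  \<open>U - {x}\<close> gives a member of \<open>M\<close> exactly when that subset is no avoider
  of \<open>rest x\<close>.\<close>

lemma card_M:
  assumes x: "x \<in> U"
  shows "card M + card (avoiders (U - {x}) (k - 1) (rest x))
    = (card U - 1 choose (k - 1)) + card (rest x)"
proof -
  let ?V = "U - {x}" and ?D = "avoiders (U - {x}) (k - 1) (rest x)" and ?L = "(\<lambda>a. a - {x}) ` {a \<in> M. x \<in> a}"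
  have "?L = nsets ?V (k - 1) - ?D"
  proof (intro equalityI subsetI)
    fix w assume "w \<in> ?L"
    then obtain a where a: "a \<in> M" "x \<in> a" "w = a - {x}" by blast
    have "w \<in> nsets ?V (k - 1)" using M(1) a by (auto simp: nsets_def)
    moreover have "w \<inter> b \<noteq> {}" if "b \<in> rest x" for b
      using M(2) a that unfolding rest_def intersecting_def by blast
    ultimately show "w \<in> nsets ?V (k - 1) - ?D" unfolding avoiders_def by blast
  next
    fix w assume w: "w \<in> nsets ?V (k - 1) - ?D"
    have "insert x w \<in> M"
    proof (rule maximal)
      have "x \<notin> w" "w \<subseteq> U" "finite w" "card w = k - 1" using w by (auto simp: nsets_def)
      then show "insert x w \<in> nsets U k" using x k by (simp add: nsets_def)
      show "insert x w \<inter> y \<noteq> {}" if "y \<in> M" for y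
        using w that unfolding avoiders_def rest_def by (cases "x \<in> y") auto
    qed
    moreover have "w = insert x w - {x}" using w by (auto simp: nsets_def)
    ultimately show "w \<in> ?L" by blast
  qed
  moreover have "?D \<subseteq> nsets ?V (k - 1)" unfolding avoiders_def by blast
  ultimately have "card ?L + card ?D = card U - 1 choose (k - 1)"
    using x finite_U finite_imp_finite_nsets[of ?V "k - 1"] card_nsets[of ?V "k - 1"]
      card_Diff_subset[of ?D] card_mono[of "nsets ?V (k - 1)" ?D] finite_subset[of ?D]
    by simp
  moreover have "card M = card {a \<in> M. x \<in> a} + card (rest x)"
    unfolding rest_def using finite_M
    by (subst card_Un_disjoint[symmetric]) (auto intro!: arg_cong[where f = card])
  ultimately show ?thesis unfolding card_link by simp
qed

text \<open>Agreement on level \<open>k\<close> forces agreement on level \<open>k - 1\<close>. The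
  lower level decides which sets through \<open>x\<close> belong to \<open>M\<close>, the upper one
  helps to decide this for sets avoiding \<open>x\<close>.\<close>

lemma generated_eq:
  assumes x: "x \<in> U" and T: "T \<subseteq> rest x" "avoiders (U - {x}) k T = avoiders (U - {x}) k (rest x)"
  shows "generated U k x T = M"
proof -
  define P where "P = {a \<in> nsets U k. x \<in> a \<and> (\<forall>t\<in>T. a \<inter> t \<noteq> {})}"
  have TM: "t \<in> M" "x \<notin> t" if "t \<in> T" for t using T(1) that unfolding rest_def by auto
  have eq: "avoiders (U - {x}) (k - 1) T = avoiders (U - {x}) (k - 1) (rest x)"
    by (rule avoiders_pred_eq[OF _ _ _ rest_subset T]) (use finite_U k x in auto)
  have P: "P = {a \<in> M. x \<in> a}"
  proof (intro equalityI subsetI)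
    fix a assume a: "a \<in> P"
    have "a \<in> M"
    proof (rule maximal)
      show "a \<in> nsets U k" using a unfolding P_def by blast
      show "a \<inter> y \<noteq> {}" if "y \<in> M" for y
      proof
        assume "a \<inter> y = {}"
        \<comment> \<open>If \<open>a\<close> misses a member, then \<open>a - {x}\<close> is an
          avoider of \<open>rest x\<close>, hence of \<open>T\<close>, so \<open>a\<close> misses a
          member of \<open>T\<close>.\<close>
        then have "y \<in> rest x" using a that unfolding rest_def P_def by blast
        moreover have "a - {x} \<in> nsets (U - {x}) (k - 1)" using a by (auto simp: P_def nsets_def)
        moreover have "(a - {x}) \<inter> y = {}" using \<open>a \<inter> y = {}\<close> by blast
        ultimately have "a - {x} \<in> avoiders (U - {x}) (k - 1) (rest x)"
          unfolding avoiders_def by (intro CollectI conjI bexI[of _ y])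
        then have "a - {x} \<in> avoiders (U - {x}) (k - 1) T" using eq by simp
        then obtain t where t: "t \<in> T" "(a - {x}) \<inter> t = {}" unfolding avoiders_def by blast
        then have "a \<inter> t = {}" using TM(2) by blast
        then show False using a t(1) unfolding P_def by blast
      qed
    qed
    then show "a \<in> {a \<in> M. x \<in> a}" using a unfolding P_def by blast
  next
    fix a assume "a \<in> {a \<in> M. x \<in> a}"
    then show "a \<in> P" using M TM unfolding P_def intersecting_def by blast
  qed
  moreover
  have "{z \<in> nsets U k. x \<notin> z \<and> (\<forall>t\<in>T. z \<inter> t \<noteq> {}) \<and> (\<forall>a\<in>P. z \<inter> a \<noteq> {})} = rest x"
  proof (intro equalityI subsetI)
    fix z assume z: "z \<in> {z \<in> nsets U k. x \<notin> z \<and> (\<forall>t\<in>T. z \<inter> t \<noteq> {}) \<and> (\<forall>a\<in>P. z \<inter> a \<noteq> {})}"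
    then have z': "z \<in> nsets U k" "x \<notin> z" "\<forall>t\<in>T. z \<inter> t \<noteq> {}" "\<forall>a\<in>P. z \<inter> a \<noteq> {}"
      by simp_all
    then have "z \<in> nsets (U - {x}) k" by (auto simp: nsets_def)
    moreover have "z \<notin> avoiders (U - {x}) k (rest x)"
      unfolding T(2)[symmetric] using z'(3) by (simp add: avoiders_def)
    ultimately have rest: "\<forall>y\<in>rest x. z \<inter> y \<noteq> {}" by (simp add: avoiders_def)
    have "z \<in> M"
    proof (rule maximal[OF z'(1)])
      fix y assume "y \<in> M"
      then show "z \<inter> y \<noteq> {}"
        using rest z'(4) P unfolding rest_def by (cases "x \<in> y") simp_all
    qed
    then show "z \<in> rest x" using z'(2) unfolding rest_def by simp
  next
    fix z assume "z \<in> rest x"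
    then show "z \<in> {z \<in> nsets U k. x \<notin> z \<and> (\<forall>t\<in>T. z \<inter> t \<noteq> {}) \<and> (\<forall>a\<in>P. z \<inter> a \<noteq> {})}"
      using M TM P unfolding rest_def intersecting_def by blast
  qed
  ultimately show ?thesis
    unfolding generated_def P_def[symmetric] Let_def rest_def by auto
qed

text \<open>Each member of \<open>M\<close> lies in \<open>rest x\<close> for \<open>n - k\<close>
  elements \<open>x\<close>, and Erdos--Ko--Rado bounds \<open>M\<close>. The average is rewritten
  by \<open>(n - k) * N = (n - 1) * (n - 2 choose (k - 1))\<close> to fit
  \<open>card_avoiders_expand\<close>.\<close>

lemma ex_small_rest:
  obtains x where "x \<in> U"
    "real (card (rest x)) \<le> (1 - 1 / real (card U)) * real (card U - 2 choose (k - 1))"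
proof -
  define n where "n = card U"
  define N where "N = n - 1 choose (k - 1)"
  have n: "0 < n" using k unfolding n_def by simp
  have "card M \<le> N"
    unfolding N_def n_def using finite_U k M by (intro erdos_ko_rado) auto
  have deg: "(\<Sum>x\<in>U. card {a \<in> M. x \<in> a}) = k * card M"
    using M(1) by (intro sum_degrees finite_M finite_U) (auto simp: nsets_def)
  have "(\<Sum>x\<in>U. card {a \<in> M. x \<in> a}) + (\<Sum>x\<in>U. card (rest x)) = (\<Sum>x\<in>U. card M)"
    unfolding sum.distrib[symmetric] rest_def using finite_M
    by (intro sum.cong refl, subst card_Un_disjoint[symmetric]) (auto intro!: arg_cong[where f = card])
  with deg have "(\<Sum>x\<in>U. card (rest x)) = (n - k) * card M"
    unfolding n_def by (simp add: diff_mult_distrib)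
  also have "\<dots> \<le> (n - k) * N" using \<open>card M \<le> N\<close> by simp
  finally have le: "(\<Sum>x\<in>U. card (rest x)) \<le> (n - k) * N" .
  have "\<exists>x\<in>U. n * card (rest x) \<le> (n - k) * N"
  proof (rule ccontr)
    assume "\<not> ?thesis"
    then have "(\<Sum>x\<in>U. (n - k) * N) < (\<Sum>x\<in>U. n * card (rest x))"
      using n finite_U unfolding n_def by (intro sum_strict_mono) auto
    then have "n * ((n - k) * N) < n * (\<Sum>x\<in>U. card (rest x))"
      unfolding n_def by (simp add: sum_distrib_left)
    then show False using le by simp
  qed
  then obtain x where x: "x \<in> U" "n * card (rest x) \<le> (n - k) * N" by blast
  have "(n - k) * N = (n - 1) * (n - 2 choose (k - 1))"
    using binomial_absorb_comp[of "n - 1" "k - 1"] k unfolding N_def n_def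
    by (simp add: numeral_2_eq_2)
  then have "real n * real (card (rest x)) \<le> real (n - 1) * real (n - 2 choose (k - 1))"
    using x(2) by (metis of_nat_le_iff of_nat_mult)
  then have "real (card (rest x)) \<le> (1 - 1 / real n) * real (n - 2 choose (k - 1))"
    using n by (simp add: field_simps)
  then show thesis using that x(1) unfolding n_def by blast
qed

text \<open>The deficit of \<open>M\<close> below \<open>N\<close> is
  \<open>g - card (rest x)\<close>, at least \<open>g / (2 * n ^ 2)\<close> by expansion, whereas
  \<open>big\<close> and irredundance give \<open>g \<ge> 4 * n ^ 3 * card T\<close>. The resulting
  deficit \<open>2 * n * card T\<close> pays for the choice of \<open>T\<close> in the
  count.\<close>

lemma ex_generated:
  assumes nontriv: "\<And>x. x \<in> U \<Longrightarrow> \<exists>b\<in>M. x \<notin> b"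
    and big: "4 ^ k * (4 * card U ^ 4) \<le> card U - 1 choose (k - 1)"
  obtains x T where "x \<in> U" "T \<subseteq> nsets U k" "T \<noteq> {}" "M = generated U k x T"
    "card M + 2 * card U * card T \<le> card U - 1 choose (k - 1)"
proof -
  define n where "n = card U"
  define N where "N = n - 1 choose (k - 1)"
  obtain x where x: "x \<in> U"
    and small: "real (card (rest x)) \<le> (1 - 1 / real n) * real (n - 2 choose (k - 1))"
    using ex_small_rest unfolding n_def by blast
  define V where "V = U - {x}"
  have V: "finite V" "n = Suc (card V)"
    using finite_U card_Suc_Diff1[OF finite_U x] unfolding V_def n_def by simp_all
  have kn: "2 * k + 1 \<le> n" using k unfolding n_def by simp
  note B = rest_subset[of x, folded V_def]
  obtain T where T: "T \<subseteq> rest x" "avoiders V k T = avoiders V k (rest x)"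
    and irr: "\<And>b. b \<in> T \<Longrightarrow> avoiders V k (T - {b}) \<noteq> avoiders V k T"
    using ex_irredundant[of "rest x" V k] finite_M unfolding rest_def by auto
  define g where "g = card (avoiders V (k - 1) (rest x))"
  \<comment> \<open>Non-triviality provides some \<open>b\<close> in \<open>rest x\<close>, and
    \<open>V - b\<close> has at least \<open>k\<close> points, so level-\<open>k\<close> avoiders
    exist; an empty \<open>T\<close> would have none.\<close>
  have "T \<noteq> {}"
  proof
    assume "T = {}"
    then have none: "avoiders V k (rest x) = {}" using T(2) unfolding avoiders_def by simp
    obtain b where b: "b \<in> rest x" using nontriv[OF x] unfolding rest_def by blast
    then have "b \<subseteq> V" "card b = k" "finite b" using B by (auto simp: nsets_def)
    then have "k \<le> card (V - b)" using V kn by (simp add: card_Diff_subset)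
    then obtain z where "z \<subseteq> V - b" "card z = k" "finite z" by (rule obtain_subset_with_card_n)
    then have "z \<in> avoiders V k (rest x)" using b unfolding avoiders_def nsets_def by blast
    then show False using none by blast
  qed
  moreover have "T \<subseteq> nsets U k" using T(1) M(1) unfolding rest_def by blast
  moreover have "M = generated U k x T" using generated_eq[OF x T[unfolded V_def]] by simp
  moreover have "card M + 2 * n * card T \<le> N"
  proof -
    have "card T * N \<le> card (avoiders V (k - 1) T) * (4 ^ k * n)"
      using card_irredundant_le[of V k T] V kn T(1) B irr unfolding N_def by auto
    also have "avoiders V (k - 1) T = avoiders V (k - 1) (rest x)"
      by (rule avoiders_pred_eq[OF _ _ _ B T]) (use V kn k in auto)
    finally have "card T * N \<le> g * (4 ^ k * n)" unfolding g_def .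
    moreover have "card T * (4 ^ k * (4 * n ^ 4)) \<le> card T * N"
      using big unfolding N_def n_def by (rule mult_le_mono2)
    ultimately have "card T * (4 ^ k * (4 * n ^ 4)) \<le> g * (4 ^ k * n)" by linarith
    then have "(4 ^ k * n) * (card T * (4 * n ^ 3)) \<le> (4 ^ k * n) * g"
      by (simp add: algebra_simps power4_eq_xxxx power3_eq_cube)
    then have T_le: "card T * (4 * n ^ 3) \<le> g" using V(2) by simp
    have "real (card (rest x)) \<le> (1 - 1 / (2 * real n ^ 2)) * real g"
      unfolding g_def using V kn k B small by (intro card_avoiders_expand) auto
    then have "real (card (rest x)) + real g / (2 * real n ^ 2) \<le> real g"
      by (simp add: algebra_simps)
    moreover have "2 * real n * real (card T) \<le> real g / (2 * real n ^ 2)"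
    proof -
      have "real (card T * (4 * n ^ 3)) \<le> real g" using T_le by (simp only: of_nat_le_iff)
      moreover have "0 < real n" using V(2) by simp
      ultimately show ?thesis
        by (simp add: field_simps power2_eq_square power3_eq_cube)
    qed
    moreover have "real (card M) + real g = real N + real (card (rest x))"
      using card_M[OF x] unfolding g_def N_def V_def n_def by (simp flip: of_nat_add)
    ultimately have "real (card M + 2 * n * card T) \<le> real N" by simp
    then show ?thesis by (simp only: of_nat_le_iff)
  qed
  ultimately show thesis using that x unfolding n_def N_def by blast
qed

end

section \<open>Estimates of binomial coefficients\<close>

text \<open>The coefficient grows by the factor \<open>n / (n - k + 1)\<close>, at least
  \<open>n / (n - 4)\<close> as \<open>k \<ge> 5\<close>, and
  \<open>(n + 1) ^ 4 * (n - 4) \<le> n ^ 5\<close>.\<close>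

lemma binomial_lower_bound_step:
  assumes k: "5 \<le> k" "k \<le> n" and le: "4 ^ k * (4 * n ^ 4) \<le> n - 1 choose (k - 1)"
  shows "4 ^ k * (4 * Suc n ^ 4) \<le> n choose (k - 1)"
proof -
  let ?p = "n - (k - 1)"
  define i where "i = n - 4"
  have i: "n = i + 4" using k unfolding i_def by simp
  have "Suc n ^ 4 * ?p \<le> Suc n ^ 4 * i" using k i by (intro mult_le_mono2) simp
  also have "\<dots> = (i + 5) ^ 4 * i" unfolding i by (simp add: add.commute)
  also have "\<dots> \<le> (i + 4) ^ 5" by (simp add: algebra_simps power_numeral_reduce)
  also have "\<dots> = n ^ 5" unfolding i by simp
  finally have "4 ^ k * 4 * (Suc n ^ 4 * ?p) \<le> 4 ^ k * 4 * n ^ 5" by (rule mult_le_mono2)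
  also have "\<dots> = n * (4 ^ k * (4 * n ^ 4))" by (simp add: power_numeral_reduce)
  also have "\<dots> \<le> n * (n - 1 choose (k - 1))" using le by (rule mult_le_mono2)
  also have "\<dots> = ?p * (n choose (k - 1))" using binomial_absorb_comp[of n "k - 1"] by simp
  finally have "?p * (4 ^ k * (4 * Suc n ^ 4)) \<le> ?p * (n choose (k - 1))" by (simp only: mult_ac)
  moreover have "0 < ?p" using k by simp
  ultimately show ?thesis by (simp only: mult_le_cancel1)
qed

text \<open>Raising the upper entry \<open>2 * k - 1 + s\<close> by 1 multiplies the coefficient by
  \<open>(2 * k + s) / (k + 1 + s)\<close>, at least \<open>3 / 2\<close> while
  \<open>s + 3 \<le> k\<close>.\<close>

lemma binomial_ge_three_halves_power:
  assumes "s + 3 \<le> k"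
  shows "(3 / 2) ^ s * real (2 * k - 1 choose (k - 1)) \<le> real (2 * k - 1 + s choose (k - 1))"
  using assms
proof (induction s)
  case 0
  then show ?case by simp
next
  case (Suc s)
  let ?c = "\<lambda>i. real (2 * k - 1 + i choose (k - 1))"
  have "Suc (2 * k - 1 + s) - (k - 1) = k + 1 + s" "Suc (2 * k - 1 + s) = 2 * k + s"
    using Suc.prems by auto
  then have "(k + 1 + s) * (2 * k - 1 + Suc s choose (k - 1)) = (2 * k + s) * (2 * k - 1 + s choose (k - 1))"
    using binomial_absorb_comp[of "Suc (2 * k - 1 + s)" "k - 1"] by simp
  then have eq: "real (k + 1 + s) * ?c (Suc s) = real (2 * k + s) * ?c s"
    by (metis of_nat_mult)
  have "real (k + 1 + s) * (3 / 2 * ?c s) = (3 / 2 * real (k + 1 + s)) * ?c s" by simp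
  also have "\<dots> \<le> real (2 * k + s) * ?c s" using Suc.prems by (intro mult_right_mono) auto
  also have "\<dots> = real (k + 1 + s) * ?c (Suc s)" using eq by simp
  finally have "3 / 2 * ?c s \<le> ?c (Suc s)" by (rule mult_left_le_imp_le) simp
  then show ?case using Suc by simp
qed

text \<open>At \<open>n = 2 * k + s\<close>, with \<open>s\<close> the integer part of
  \<open>100 * ln k\<close>, the central coefficient supplies \<open>4 ^ k / (4 * k)\<close> and the
  \<open>s\<close> extra steps supply \<open>(3 / 2) ^ s \<ge> k ^ 6\<close>. Induction extends the
  bound to larger \<open>n\<close>.\<close>

lemma eventually_binomial_large:
  "\<forall>\<^sub>F k in sequentially. \<forall>n. real n \<ge> 2 * real k + 100 * ln (real k)
    \<longrightarrow> 4 ^ k * (4 * n ^ 4) \<le> n - 1 choose (k - 1)"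
proof -
  \<comment> \<open>The constant makes \<open>100 * ln k\<close> at most \<open>k / 2\<close>, hence
    \<open>s + 3 \<le> k\<close>.\<close>
  have "\<forall>\<^sub>F k in sequentially. ln (real k) / real k < 1 / 200"
    using filterlim_compose[OF ln_x_over_x_tendsto_0 filterlim_real_sequentially]
    by (rule order_tendstoD) simp
  then show ?thesis
    \<comment> \<open>\<open>1296 = 4 * 3 ^ 4 * 4\<close>: the leading 4, the bound
      \<open>2 * k + s \<le> 3 * k\<close>, and the denominator \<open>4 * k\<close> of the central
      estimate.\<close>
    using eventually_ge_at_top[of 1296]
  proof eventually_elim
    case (elim k)
    then have k: "1296 \<le> k" by simp
    define s where "s = nat \<lfloor>100 * ln (real k)\<rfloor>"
    have "exp 1 \<le> real k" using exp_le k by linarith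
    then have ln1: "1 \<le> ln (real k)" using k by (subst ln_ge_iff) auto
    have s: "real s \<le> 100 * ln (real k)" "100 * ln (real k) \<le> real s + 1"
      unfolding s_def using ln1 by linarith+
    have "100 * ln (real k) \<le> real k / 2" using elim k by (simp add: field_simps)
    then have sk: "s + 3 \<le> k" using s(1) k by linarith
    have "real k ^ 6 = exp (6 * ln (real k))" using k by (simp add: exp_of_nat_mult[of 6, simplified])
    also have "\<dots> \<le> exp (real s * ln (3 / 2))"
    proof -
      \<comment> \<open>This is \<open>ln (1 + t) \<le> t\<close> at \<open>t = - 1 / 3\<close>, as
        \<open>ln (3 / 2) = - ln (2 / 3)\<close>.\<close>
      have "1 / 3 \<le> ln (3 / 2 :: real)" 
        using ln_add_one_self_le_self2[of "- 1 / 3"] ln_div[of 2 "3::real"] ln_div[of 3 "2::real"] by simp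
      then have "real s * (1 / 3) \<le> real s * ln (3 / 2)" by (intro mult_left_mono) auto
      moreover have "6 * ln (real k) \<le> real s * (1 / 3)" using s(2) ln1 by linarith
      ultimately show ?thesis unfolding exp_le_cancel_iff by (rule order_trans[rotated])
    qed
    also have "\<dots> = (3 / 2) ^ s" by (simp add: exp_of_nat_mult)
    finally have pow: "real k ^ 6 \<le> (3 / 2) ^ s" .
    have "real (4 ^ k * (4 * (2 * k + s) ^ 4)) \<le> 4 ^ k * (4 * (3 * real k) ^ 4)"
    proof -
      have "real (2 * k + s) \<le> 3 * real k" using sk by simp
      then have "real (2 * k + s) ^ 4 \<le> (3 * real k) ^ 4" by (intro power_mono) auto
      then show ?thesis by simp
    qed
    also have "\<dots> = (1296 * real k ^ 5) * (4 ^ k / (4 * real k))"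
      using k by (simp add: power_mult_distrib power_numeral_reduce field_simps)
    also have "\<dots> \<le> (3 / 2) ^ s * real (2 * k - 1 choose (k - 1))"
    proof (intro mult_mono)
      have "1296 * real k ^ 5 \<le> real k * real k ^ 5" using k by (intro mult_right_mono) auto
      then show "1296 * real k ^ 5 \<le> (3 / 2) ^ s" using pow by (simp add: power_numeral_reduce)
      have "4 ^ k / (2 * real k) \<le> real (2 * k choose k)"
        using k by (intro central_binomial_lower_bound) simp
      moreover have "2 * k choose k = 2 * (2 * k - 1 choose (k - 1))"
        using k times_binomial_minus1_eq[of k "2 * k"] by simp
      ultimately show "4 ^ k / (4 * real k) \<le> real (2 * k - 1 choose (k - 1))"
        using k by (simp add: field_simps)
    qed auto
    also have "\<dots> \<le> real (2 * k - 1 + s choose (k - 1))"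
      using sk by (rule binomial_ge_three_halves_power)
    finally have "4 ^ k * (4 * (2 * k + s) ^ 4) \<le> 2 * k - 1 + s choose (k - 1)"
      by (simp only: of_nat_le_iff)
    then have base: "4 ^ k * (4 * (2 * k + s) ^ 4) \<le> (2 * k + s) - 1 choose (k - 1)"
      using k by simp
    show ?case
    proof (intro allI impI)
      fix n assume "2 * real k + 100 * ln (real k) \<le> real n"
      then have "2 * k + s \<le> n" using s(1) by linarith
      then show "4 ^ k * (4 * n ^ 4) \<le> n - 1 choose (k - 1)"
      proof (induction n rule: dec_induct)
        case base
        show ?case using \<open>4 ^ k * (4 * (2 * k + s) ^ 4) \<le> (2 * k + s) - 1 choose (k - 1)\<close> .
      next
        case (step n)
        then show ?case using binomial_lower_bound_step[of k n] k by simp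
      qed
    qed
  qed
qed

section \<open>Counting\<close>

lemma sum_Pow_power_card:
  fixes q :: real
  assumes "finite X"
  shows "(\<Sum>T\<in>Pow X. q ^ card T) = (1 + q) ^ card X"
  using assms
proof induction
  case empty
  then show ?case by simp
next
  case (insert x X)
  have "(\<Sum>T\<in>Pow (insert x X). q ^ card T)
      = (\<Sum>T\<in>Pow X. q ^ card T) + (\<Sum>T\<in>insert x ` Pow X. q ^ card T)"
    unfolding Pow_insert using insert by (intro sum.union_disjoint) auto
  also have "(\<Sum>T\<in>insert x ` Pow X. q ^ card T) = (\<Sum>T\<in>Pow X. q ^ card (insert x T))"
    using insert by (intro sum.reindex_cong[of "insert x"]) (auto simp: inj_on_def)
  also have "\<dots> = (\<Sum>T\<in>Pow X. q * q ^ card T)"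
  proof (rule sum.cong)
    fix T assume "T \<in> Pow X"
    then have "x \<notin> T" "finite T" using insert finite_subset by auto
    then show "q ^ card (insert x T) = q * q ^ card T" by simp
  qed simp
  finally show ?case using insert by (simp add: algebra_simps flip: sum_distrib_left)
qed

text \<open>\<open>1 + q \<le> exp q\<close>, followed by the quadratic bound for \<open>exp\<close>
  on the unit interval.\<close>

lemma one_plus_power_le:
  fixes q :: real
  assumes "0 \<le> q" "q * real L \<le> 1"
  shows "(1 + q) ^ L - 1 \<le> 2 * (q * real L)"
proof -
  have "(1 + q) ^ L \<le> exp q ^ L" using assms by (intro power_mono) auto
  also have "\<dots> = exp (q * real L)" by (metis exp_of_nat_mult mult.commute)
  also have "\<dots> \<le> 1 + q * real L + (q * real L)\<^sup>2" using assms by (intro exp_bound) auto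
  also have "(q * real L)\<^sup>2 \<le> q * real L"
    using assms by (simp add: power2_eq_square mult_left_le)
  finally show ?thesis by simp
qed

text \<open>Enlarging a non-trivial family cannot make it trivial, so maximality among non-trivial
  intersecting families is maximality among all intersecting ones.\<close>

lemma ex_maximal_intersecting:
  assumes F: "F \<in> nontrivial_intersecting_families n k" and k: "2 \<le> k" "2 * k < n"
  obtains M where "F \<subseteq> M" "maximal_intersecting {1..n} k M" "\<And>x. x \<in> {1..n} \<Longrightarrow> \<exists>b\<in>M. x \<notin> b"
proof -
  let ?S = "nontrivial_intersecting_families n k"
  have "?S \<subseteq> Pow (nsets {1..n} k)"
    unfolding nontrivial_intersecting_families_def intersecting_families_def by blast
  then have fin: "finite ?S" using finite_imp_finite_nsets[of "{1..n}" k] finite_subset by blast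
  from finite_has_maximal2[OF fin F] obtain M
    where M: "M \<in> ?S" "F \<subseteq> M" "\<forall>S\<in>?S. M \<subseteq> S \<longrightarrow> M = S"
    by (elim bexE conjE)
  have M': "M \<subseteq> nsets {1..n} k" "intersecting M" "\<not> trivial_family n k M"
    using M(1) unfolding nontrivial_intersecting_families_def intersecting_families_def by auto
  have "maximal_intersecting {1..n} k M"
  proof
    fix z assume z: "z \<in> nsets {1..n} k" "\<And>y. y \<in> M \<Longrightarrow> z \<inter> y \<noteq> {}"
    have "z \<noteq> {}" using z(1) k by (auto simp: nsets_def)
    have "intersecting (insert z M)"
      unfolding intersecting_def
    proof (intro ballI)
      fix A B assume AB: "A \<in> insert z M" "B \<in> insert z M"
      consider "A \<in> M" "B \<in> M" | "A = z" "B = z" | "A = z" "B \<in> M" | "A \<in> M" "B = z"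
        using AB by blast
      then show "A \<inter> B \<noteq> {}"
        by cases (use M'(2) z(2) \<open>z \<noteq> {}\<close> in \<open>auto simp: intersecting_def Int_commute\<close>)
    qed
    moreover have "\<not> trivial_family n k (insert z M)"
      using M'(3) unfolding trivial_family_def by blast
    ultimately have "insert z M \<in> ?S"
      using M'(1) z(1) unfolding nontrivial_intersecting_families_def intersecting_families_def
      by simp
    then have "M = insert z M" using M(3) by blast
    then show "z \<in> M" by blast
  qed (use M' k in auto)
  moreover have "\<exists>b\<in>M. x \<notin> b" if "x \<in> {1..n}" for x
    using M'(1,3) that unfolding trivial_family_def star_def by blast
  ultimately show thesis using that M(2) by blast
qed

text \<open>Union bound: every non-trivial family lies in some \<open>generated U k x T\<close> with
  \<open>T\<close> non-empty and size deficit \<open>2 * n * card T\<close>. The deficit weights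
  \<open>T\<close> by \<open>q ^ card T\<close>, and these weights sum to
  \<open>(1 + q) ^ card X - 1\<close>, where \<open>q * card X \<le> (1 / 2) ^ n\<close>.\<close>

lemma I_nontrivial_le:
  assumes k: "2 \<le> k" "2 * k < n" and big: "4 ^ k * (4 * n ^ 4) \<le> n - 1 choose (k - 1)"
  shows "real (I_nontrivial n k) \<le> 2 * (real n * (1 / 2) ^ n) * 2 ^ (n - 1 choose (k - 1))"
proof -
  define U where "U = {1..n}"
  define X where "X = nsets U k"
  define N where "N = n - 1 choose (k - 1)"
  define q :: real where "q = (1 / 4) ^ n"
  have U: "finite U" "card U = n" unfolding U_def by auto
  have X: "finite X" "card X = n choose k"
    unfolding X_def using U by (auto simp: finite_imp_finite_nsets card_nsets)
  have gen: "generated U k x T \<subseteq> X" for x T unfolding generated_def Let_def X_def by blast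
  \<comment> \<open>Pairs violating the size bound contribute nothing, so \<open>card_Q\<close>
    holds for all \<open>x\<close> and \<open>T\<close>; the pairs supplied by
    \<open>ex_generated\<close> satisfy it.\<close>
  define Q where "Q x T = (if card (generated U k x T) + 2 * n * card T \<le> N
    then Pow (generated U k x T) else {})" for x T
  have card_Q: "real (card (Q x T)) \<le> 2 ^ N * q ^ card T" for x T
  proof (cases "card (generated U k x T) + 2 * n * card T \<le> N")
    case True
    have "2 ^ card (generated U k x T) * (2::real) ^ (2 * n * card T) \<le> 2 ^ N"
      unfolding power_add[symmetric] using True by (rule power_increasing) simp
    moreover have "(2::real) ^ (2 * n * card T) = (1 / q) ^ card T"
      unfolding q_def by (simp add: power_mult power_divide)
    moreover have "card (Q x T) = 2 ^ card (generated U k x T)"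
      using True finite_subset[OF gen X(1)] by (simp add: Q_def card_Pow)
    ultimately show ?thesis by (simp add: power_divide field_simps q_def)
  next
    case False
    then show ?thesis by (simp add: Q_def q_def)
  qed
  have fin_Q: "finite (Q x T)" for x T
    using finite_subset[OF gen X(1)] by (simp add: Q_def)
  have "nontrivial_intersecting_families n k \<subseteq> (\<Union>x\<in>U. \<Union>T\<in>Pow X - {{}}. Q x T)"
  proof
    fix F assume "F \<in> nontrivial_intersecting_families n k"
    then obtain M where max: "F \<subseteq> M" "maximal_intersecting U k M" "\<And>x. x \<in> U \<Longrightarrow> \<exists>b\<in>M. x \<notin> b"
      unfolding U_def using k by (rule ex_maximal_intersecting) blast
    interpret maximal_intersecting U k M by (rule max(2))
    obtain x T where "x \<in> U" "T \<subseteq> X" "T \<noteq> {}" "M = generated U k x T"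
      "card M + 2 * n * card T \<le> N"
      using ex_generated[OF max(3)] big unfolding U(2) X_def N_def by blast
    then show "F \<in> (\<Union>x\<in>U. \<Union>T\<in>Pow X - {{}}. Q x T)"
      using max(1) unfolding Q_def by auto
  qed
  then have "I_nontrivial n k \<le> card (\<Union>x\<in>U. \<Union>T\<in>Pow X - {{}}. Q x T)"
    unfolding I_nontrivial_def using U X fin_Q by (intro card_mono) auto
  also have "\<dots> \<le> (\<Sum>x\<in>U. card (\<Union>T\<in>Pow X - {{}}. Q x T))"
    by (rule card_UN_le) (rule U)
  also have "\<dots> \<le> (\<Sum>x\<in>U. \<Sum>T\<in>Pow X - {{}}. card (Q x T))"
    using X by (intro sum_mono card_UN_le) auto
  finally have "real (I_nontrivial n k) \<le> real (\<Sum>x\<in>U. \<Sum>T\<in>Pow X - {{}}. card (Q x T))"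
    by (simp only: of_nat_le_iff)
  also have "\<dots> \<le> (\<Sum>x\<in>U. \<Sum>T\<in>Pow X - {{}}. 2 ^ N * q ^ card T)"
    unfolding of_nat_sum by (intro sum_mono card_Q)
  \<comment> \<open>The subtracted 1 is the term of the empty \<open>T\<close>.\<close>
  also have "\<dots> = real n * 2 ^ N * ((1 + q) ^ card X - 1)"
    using X(1) U(2) sum_Pow_power_card[OF X(1), of q]
    by (simp add: sum_diff1 flip: sum_distrib_left)
  also have "\<dots> \<le> real n * 2 ^ N * (2 * (1 / 2) ^ n)"
  proof (rule mult_left_mono)
    have "real (card X) \<le> 2 ^ n"
      unfolding X(2) using binomial_le_pow2[of n k] by (metis of_nat_le_iff of_nat_numeral of_nat_power)
    then have "q * real (card X) \<le> q * 2 ^ n"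
      unfolding q_def by (intro mult_left_mono) auto
    also have "q * 2 ^ n = (1 / 2) ^ n" unfolding q_def by (simp flip: power_mult_distrib)
    finally have q: "q * real (card X) \<le> (1 / 2) ^ n" .
    moreover have "(1 / 2 :: real) ^ n \<le> 1" by (simp add: power_le_one)
    ultimately have "(1 + q) ^ card X - 1 \<le> 2 * (q * real (card X))"
      by (intro one_plus_power_le) (auto simp: q_def)
    then show "(1 + q) ^ card X - 1 \<le> 2 * (1 / 2) ^ n" using q by simp
  qed simp
  finally show ?thesis unfolding N_def by (simp add: mult_ac)
qed

section \<open>Comparison with subfamilies of a star, and the limit\<close>

text \<open>Every subfamily of the star at 1 is intersecting. This bounds the denominator of the
  proportion.\<close>

lemma card_intersecting_families_ge:
  assumes "1 \<le> n" "1 \<le> k"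
  shows "2 ^ (n - 1 choose (k - 1)) \<le> card (intersecting_families n k)"
proof -
  let ?L = "insert 1 ` nsets {2..n} (k - 1)"
  have X: "finite (nsets {1..n} k)" by (simp add: finite_imp_finite_nsets)
  have "inj_on (insert 1) (nsets {2..n} (k - 1))"
  proof (rule inj_onI)
    fix A B assume "A \<in> nsets {2..n} (k - 1)" "B \<in> nsets {2..n} (k - 1)"
      and eq: "insert 1 A = insert 1 B"
    then have "1 \<notin> A" "1 \<notin> B" unfolding nsets_def by force+
    then show "A = B" using eq insert_ident[of 1 A B] by blast
  qed
  then have "card ?L = n - 1 choose (k - 1)" by (simp add: card_image card_nsets)
  moreover have "?L \<subseteq> star n k 1"
  proof (rule image_subsetI)
    fix A assume "A \<in> nsets {2..n} (k - 1)"
    then have A: "A \<subseteq> {2..n}" "finite A" "card A = k - 1" by (auto simp: nsets_def)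
    then have "1 \<notin> A" by force
    then have "card (insert 1 A) = k" using A assms by simp
    moreover have "insert 1 A \<subseteq> {1..n}" using A assms by auto
    ultimately show "insert 1 A \<in> star n k 1" using A by (simp add: star_def nsets_def)
  qed
  moreover have fin: "finite (star n k 1)" using X unfolding star_def by simp
  ultimately have "n - 1 choose (k - 1) \<le> card (star n k 1)" by (metis card_mono)
  then have "2 ^ (n - 1 choose (k - 1)) \<le> card (Pow (star n k 1))"
    using fin by (simp add: card_Pow)
  also have "\<dots> \<le> card (intersecting_families n k)"
  proof (rule card_mono)
    show "finite (intersecting_families n k)"
      unfolding intersecting_families_def using X by simp
    show "Pow (star n k 1) \<subseteq> intersecting_families n k"
      unfolding star_def intersecting_families_def intersecting_def by blast
  qed
  finally show ?thesis .
qed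

theorem theorem1p3:
  shows "\<forall>\<epsilon>::real. \<epsilon> > 0 \<longrightarrow>
    (\<exists>k\<^sub>0::nat. \<forall>k::nat. \<forall>n::nat.
       k \<ge> k\<^sub>0 \<and> real n \<ge> 2 * real k + 100 * ln (real k) \<longrightarrow>
         real (I_nontrivial n k) \<le> \<epsilon> * 2 ^ ((n - 1) choose (k - 1)) \<and>
         nontrivial_proportion n k \<le> \<epsilon>)"
proof (intro allI impI)
  fix \<epsilon> :: real assume \<epsilon>: "\<epsilon> > 0"
  \<comment> \<open>The factor from \<open>I_nontrivial_le\<close>; it becomes small with growing
    \<open>k\<close> because \<open>n > 2 * k\<close>.\<close>
  have "(\<lambda>n. real n * (1 / 2) ^ n) \<longlonglongrightarrow> 0" by (rule powser_times_n_limit_0) simp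
  then have "\<forall>\<^sub>F n in sequentially. real n * (1 / 2) ^ n < \<epsilon> / 2"
    using \<epsilon> by (intro order_tendstoD) auto
  then obtain n\<^sub>0 where n\<^sub>0: "\<And>n. n \<ge> n\<^sub>0 \<Longrightarrow> real n * (1 / 2) ^ n < \<epsilon> / 2"
    unfolding eventually_sequentially by blast
  obtain k\<^sub>1 where k\<^sub>1: "\<And>k n. k \<ge> k\<^sub>1 \<Longrightarrow> real n \<ge> 2 * real k + 100 * ln (real k) \<Longrightarrow>
      4 ^ k * (4 * n ^ 4) \<le> n - 1 choose (k - 1)"
    using eventually_binomial_large unfolding eventually_sequentially by blast
  show "\<exists>k\<^sub>0::nat. \<forall>k::nat. \<forall>n::nat.
       k \<ge> k\<^sub>0 \<and> real n \<ge> 2 * real k + 100 * ln (real k) \<longrightarrow>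
         real (I_nontrivial n k) \<le> \<epsilon> * 2 ^ ((n - 1) choose (k - 1)) \<and>
         nontrivial_proportion n k \<le> \<epsilon>"
  proof (intro exI allI impI)
    fix k n :: nat
    assume asm: "k \<ge> max 2 (max n\<^sub>0 k\<^sub>1) \<and> real n \<ge> 2 * real k + 100 * ln (real k)"
    then have k: "2 \<le> k" "n\<^sub>0 \<le> k" "k\<^sub>1 \<le> k" by auto
    have "ln (real k) > 0" using k by simp
    then have n: "2 * k < n" using asm by linarith
    let ?N = "(n - 1) choose (k - 1)"
    have "real (I_nontrivial n k) \<le> 2 * (real n * (1 / 2) ^ n) * 2 ^ ?N"
      using k n k\<^sub>1 asm by (intro I_nontrivial_le) auto
    also have "\<dots> \<le> \<epsilon> * 2 ^ ?N"
      using n\<^sub>0[of n] k n by (intro mult_right_mono) auto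
    finally have I: "real (I_nontrivial n k) \<le> \<epsilon> * 2 ^ ?N" .
    have "2 ^ ?N \<le> card (intersecting_families n k)"
      using k n by (intro card_intersecting_families_ge) auto
    then have ge: "2 ^ ?N \<le> real (card (intersecting_families n k))"
      by (metis of_nat_le_iff of_nat_numeral of_nat_power)
    then have "\<epsilon> * 2 ^ ?N \<le> \<epsilon> * real (card (intersecting_families n k))"
      using \<epsilon> by (intro mult_left_mono) auto
    moreover have "0 < real (card (intersecting_families n k))"
      using ge by (rule less_le_trans[rotated]) simp
    ultimately have "nontrivial_proportion n k \<le> \<epsilon>"
      using I unfolding nontrivial_proportion_def by (simp add: divide_le_eq)
    with I show "real (I_nontrivial n k) \<le> \<epsilon> * 2 ^ ?N \<and> nontrivial_proportion n k \<le> \<epsilon>" ..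
  qed
qed

end
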